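(* Let $\mathbf{F}:\mathcal{D}\subseteq\mathbb{C}^{m\times n}\to\mathbb{C}^{p\times q}$ be a complex matrix-valued function defined on a convex set $\mathcal{D}$, assumed to be continuous on $\mathcal{D}$ and differentiable on the interior of $\mathcal{D}$, with Jacobian matrix $\mathbf{D}_{\mathbf{X}}\mathbf{F}(\mathbf{X})$. Then, for any given $\mathbf{X},\mathbf{Y}\in\mathcal{D}$, there exists some $t\in(0,1)$ such that $$\|\mathbf{F}(\mathbf{Y})-\mathbf{F}(\mathbf{X})\|_F\le\big\|\mathbf{D}_{\mathbf{X}}\mathbf{F}\big(t\mathbf{Y}+(1-t)\mathbf{X}\big)\,\mathrm{vec}(\mathbf{Y}-\mathbf{X})\big\|_2\le\big\|\mathbf{D}_{\mathbf{X}}\mathbf{F}\big(t\mathbf{Y}+(1-t)\mathbf{X}\big)\big\|_{2,\mathrm{mat}}\,\|\mathbf{Y}-\mathbf{X}\|_F .$$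
   Context: $\mathrm{vec}(\cdot)$ stacks the columns of a matrix; $\|\cdot\|_F$ is the Frobenius norm, $\|\cdot\|_2$ the Euclidean norm, and $\|\mathbf{A}\|_{2,\mathrm{mat}}=\sqrt{\rho(\mathbf{A}^H\mathbf{A})}$ the spectral norm, where $\rho$ is the spectral radius. $\mathbf{F}$ is a function of $\mathbf{X}$ only (not of its conjugate $\mathbf{X}^*$), and differentiability at a point $\mathbf{X}_0$ with Jacobian $\mathbf{D}_{\mathbf{X}}\mathbf{F}(\mathbf{X}_0)\in\mathbb{C}^{pq\times mn}$ means that $\mathrm{vec}(\mathbf{F}(\mathbf{X}_0+d\mathbf{X}))=\mathrm{vec}(\mathbf{F}(\mathbf{X}_0))+\mathbf{D}_{\mathbf{X}}\mathbf{F}(\mathbf{X}_0)\,\mathrm{vec}(d\mathbf{X})$ up to higher-order terms in $d\mathbf{X}$.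
   Formalization: For X ≠ Y the formal theorem also assumes that the open segment from X to Y meets the interior of D; otherwise (e.g. D = [0,1] in ℂ) F is not assumed differentiable at any point tY+(1-t)X, and the Jacobian in the claim is undefined. *)

theory Defs
  imports "HOL-Analysis.Analysis"
begin

text \<open>
  An m by n complex matrix has type \<open>complex ^ 'n ^ 'm\<close>.
  The column-stacked vector is indexed by pairs (column, row): read lexicographically, with the
  column index first, this is the order in which the columns are stacked.  A pq by mn matrix
  accordingly has type \<open>complex ^ ('n \<times> 'm) ^ ('q \<times> 'p)\<close>.
  The Euclidean norm of a vector is the library \<open>norm\<close>.
\<close>

definition vec_cols :: "complex ^ 'n ^ 'm \<Rightarrow> complex ^ ('n \<times> 'm)" where
  "vec_cols A = (\<chi> k. A $ snd k $ fst k)"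

definition frobenius_norm :: "complex ^ 'n ^ 'm \<Rightarrow> real" where
  "frobenius_norm A = sqrt (\<Sum>i\<in>UNIV. \<Sum>j\<in>UNIV. (cmod (A $ i $ j))\<^sup>2)"

definition conj_transpose :: "complex ^ 'n ^ 'm \<Rightarrow> complex ^ 'm ^ 'n" where
  "conj_transpose A = (\<chi> i j. cnj (A $ j $ i))"

definition eigenvalues :: "complex ^ 'n ^ 'n \<Rightarrow> complex set" where
  "eigenvalues A = {\<mu>. \<exists>v. v \<noteq> 0 \<and> A *v v = \<mu> *s v}"

definition spectral_radius :: "complex ^ 'n ^ 'n \<Rightarrow> real" where
  "spectral_radius A = Max (cmod ` eigenvalues A)"

definition spectral_norm :: "complex ^ 'n ^ 'm \<Rightarrow> real" where
  "spectral_norm A = sqrt (spectral_radius (conj_transpose A ** A))"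

text \<open>
  The Frechet derivative over the reals is required to be multiplication by a complex matrix, and
  so is complex linear: this is differentiability in \<open>X\<close> only, not in its conjugate.
\<close>

definition has_jacobian ::
  "(complex ^ 'n ^ 'm \<Rightarrow> complex ^ 'q ^ 'p) \<Rightarrow> complex ^ 'n ^ 'm \<Rightarrow>
    complex ^ ('n \<times> 'm) ^ ('q \<times> 'p) \<Rightarrow> bool" where
  "has_jacobian F X0 J \<longleftrightarrow>
    ((\<lambda>X. vec_cols (F X)) has_derivative (\<lambda>dX. J *v vec_cols dX)) (at X0)"

end

theory Submission
  imports Defs
begin

text \<open>
  The interior of \<open>D\<close> contains the whole open segment from \<open>X\<close> to \<open>Y\<close> as soon as it contains one
  of its points, so the first inequality is the mean value inequality for inner product spaces
  along that segment. For the second, let \<open>c\<close> be the maximum of \<open>norm (A *v v)\<close> on the unit sphere: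
  a maximiser is an eigenvector of \<open>A\<^sup>H A\<close> for the eigenvalue \<open>c\<^sup>2\<close>, whence \<open>c \<le> spectral_norm A\<close>.
  Throughout, \<open>\<bullet>\<close> is the real part of the Hermitian inner product.
\<close>

lemma frobenius_norm_eq_norm: "frobenius_norm A = norm (vec_cols A)"
proof -
  have "(\<Sum>i\<in>UNIV. \<Sum>j\<in>UNIV. (cmod (A $ i $ j))\<^sup>2)
      = (\<Sum>k\<in>UNIV. (cmod (A $ snd k $ fst k))\<^sup>2)"
    by (subst sum.swap) (simp add: sum.cartesian_product case_prod_unfold)
  then show ?thesis
    by (simp add: frobenius_norm_def norm_vec_def L2_set_def vec_cols_def)
qed

lemma linear_vec_cols: "linear vec_cols"
  by (intro linearI) (simp_all add: vec_cols_def vec_eq_iff)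

text \<open>Both sides are the same finite double sum of real parts, taken in the two
  orders.\<close>

lemma inner_conj_transpose:
  fixes A :: "complex ^ 'n ^ 'm"
  shows "x \<bullet> (conj_transpose A *v y) = (A *v x) \<bullet> y"
proof -
  have "x \<bullet> (conj_transpose A *v y) = (\<Sum>i\<in>UNIV. \<Sum>j\<in>UNIV. Re (x $ i * (A $ j $ i * cnj (y $ j))))"
    by (simp add: inner_vec_def matrix_vector_mult_def conj_transpose_def inner_complex_def
        sum_distrib_left sum.distrib sum_subtractf algebra_simps)
  also have "\<dots> = (\<Sum>j\<in>UNIV. \<Sum>i\<in>UNIV. Re (x $ i * (A $ j $ i * cnj (y $ j))))"
    by (rule sum.swap)
  also have "\<dots> = (A *v x) \<bullet> y"
    by (simp add: inner_vec_def matrix_vector_mult_def inner_complex_def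
        sum_distrib_left sum.distrib sum_subtractf algebra_simps)
  finally show ?thesis .
qed

text \<open>The eigenvector is paired with its multiple by \<i>: on one side the real inner product
  then extracts \<open>Im \<mu>\<close>, on the other it compares \<open>A *v v\<close> with its own
  rotation by a right angle, which is orthogonal to it.\<close>

lemma Im_eigenvalue_conj_transpose_mult:
  fixes A :: "complex ^ 'n ^ 'm"
  assumes "\<mu> \<in> eigenvalues (conj_transpose A ** A)"
  shows "Im \<mu> = 0"
proof -
  obtain v where v: "v \<noteq> 0" and eig: "(conj_transpose A ** A) *v v = \<mu> *s v"
    using assms by (auto simp: eigenvalues_def)
  have "Im \<mu> * (v \<bullet> v) = (\<i> *s v) \<bullet> (\<mu> *s v)"
    by (simp add: inner_vec_def inner_complex_def sum_distrib_left algebra_simps)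
  also have "\<dots> = (A *v (\<i> *s v)) \<bullet> (A *v v)"
    by (simp flip: eig matrix_vector_mul_assoc add: inner_conj_transpose)
  also have "\<dots> = (\<i> *s (A *v v)) \<bullet> (A *v v)"
    by (simp add: vector_scalar_commute)
  also have "\<dots> = 0"
    by (simp add: inner_vec_def inner_complex_def)
  finally show ?thesis using v by simp
qed

text \<open>Needed because \<open>Max\<close> in the spectral radius is meaningful only for finite sets.\<close>

lemma finite_eigenvalues_conj_transpose_mult:
  fixes A :: "complex ^ 'n ^ 'm"
  shows "finite (eigenvalues (conj_transpose A ** A))"
proof -
  let ?M = "conj_transpose A ** A" and ?E = "eigenvalues (conj_transpose A ** A)"
  \<comment> \<open>One eigenvector is chosen per eigenvalue; the choice will be injective with
    pairwise orthogonal values, of which a finite-dimensional space has only finitely many.\<close>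
  have "\<forall>\<mu>\<in>?E. \<exists>v. v \<noteq> 0 \<and> ?M *v v = \<mu> *s v"
    by (simp add: eigenvalues_def)
  then obtain w where w0: "\<And>\<mu>. \<mu> \<in> ?E \<Longrightarrow> w \<mu> \<noteq> 0"
    and w: "\<And>\<mu>. \<mu> \<in> ?E \<Longrightarrow> ?M *v w \<mu> = \<mu> *s w \<mu>"
    by metis
  \<comment> \<open>A real eigenvalue can be pulled out of the real inner product.\<close>
  have re: "\<mu> *s w \<mu> = Re \<mu> *\<^sub>R w \<mu>" if "\<mu> \<in> ?E" for \<mu>
    using Im_eigenvalue_conj_transpose_mult[OF that] by (simp add: vec_eq_iff complex_eq_iff)
  have orth: "w \<mu> \<bullet> w \<nu> = 0" if "\<mu> \<in> ?E" "\<nu> \<in> ?E" "w \<mu> \<noteq> w \<nu>" for \<mu> \<nu>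
  proof -
    have "Re \<nu> * (w \<mu> \<bullet> w \<nu>) = w \<mu> \<bullet> (?M *v w \<nu>)"
      using that by (simp add: w re)
    also have "\<dots> = (A *v w \<mu>) \<bullet> (A *v w \<nu>)"
      by (simp flip: matrix_vector_mul_assoc add: inner_conj_transpose)
    also have "\<dots> = w \<nu> \<bullet> (?M *v w \<mu>)"
      by (simp flip: matrix_vector_mul_assoc add: inner_conj_transpose inner_commute)
    also have "\<dots> = Re \<mu> * (w \<mu> \<bullet> w \<nu>)"
      using that by (simp add: w re inner_commute)
    finally have "Re \<nu> = Re \<mu> \<or> w \<mu> \<bullet> w \<nu> = 0" by auto
    \<comment> \<open>Equal real parts would now force \<mu> = \<nu>, against
      \<open>w \<mu> \<noteq> w \<nu>\<close>.\<close>
    moreover have "Im \<nu> = Im \<mu>"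
      using that by (simp add: Im_eigenvalue_conj_transpose_mult)
    ultimately show ?thesis
      using that complex_eqI by metis
  qed
  have "finite (w ` ?E)"
    by (rule pairwise_orthogonal_imp_finite) (auto simp: pairwise_def orthogonal_def orth)
  moreover have "inj_on w ?E"
  proof (rule inj_onI)
    fix \<mu> \<nu> assume *: "\<mu> \<in> ?E" "\<nu> \<in> ?E" "w \<mu> = w \<nu>"
    then have "\<mu> *s w \<mu> = \<nu> *s w \<mu>" using w by metis
    then show "\<mu> = \<nu>" using w0[OF *(1)] by simp
  qed
  ultimately show ?thesis by (rule finite_imageD)
qed

lemma norm_mult_vec_le_spectral_norm:
  fixes A :: "complex ^ 'n ^ 'm"
  shows "norm (A *v v) \<le> spectral_norm A * norm v"
proof -
  let ?M = "conj_transpose A ** A"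
  interpret A: linear "(*v) A" by (rule matrix_vector_mul_linear)
  \<comment> \<open>Any unit vector will do: the sphere must be nonempty for the maximum to be
    attained.\<close>
  have "axis undefined 1 \<in> sphere (0 :: complex ^ 'n) 1" by simp
  then have "\<exists>u\<in>sphere (0 :: complex ^ 'n) 1. \<forall>v\<in>sphere 0 1. norm (A *v v) \<le> norm (A *v u)"
    by (intro continuous_attains_sup continuous_intros linear_continuous_on
        linear_conv_bounded_linear[THEN iffD1] matrix_vector_mul_linear) auto
  then obtain u where u: "norm u = 1" and max: "\<And>v. norm v = 1 \<Longrightarrow> norm (A *v v) \<le> norm (A *v u)"
    by auto
  define c where "c = norm (A *v u)"
  have c: "norm (A *v v) \<le> c * norm v" for v
  proof (cases "v = 0")
    case False
    have "norm (A *v v) = norm v * norm (A *v ((1 / norm v) *\<^sub>R v))"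
      using False by (simp add: A.scaleR)
    also have "\<dots> \<le> norm v * c"
      unfolding c_def using False by (intro mult_left_mono max) auto
    finally show ?thesis by (simp add: mult.commute)
  qed simp
  \<comment> \<open>The adjoint obeys the same bound: after moving it across the inner product,
    Cauchy-Schwarz leaves one factor \<open>norm ?z\<close> to cancel.\<close>
  have adj: "norm (conj_transpose A *v w) \<le> c * norm w" for w
  proof -
    let ?z = "conj_transpose A *v w"
    have "norm ?z * norm ?z = (A *v ?z) \<bullet> w"
      by (simp flip: inner_conj_transpose power2_eq_square add: power2_norm_eq_inner)
    also have "\<dots> \<le> norm (A *v ?z) * norm w" by (rule norm_cauchy_schwarz)
    also have "\<dots> \<le> (c * norm ?z) * norm w" by (intro mult_right_mono c) simp
    finally have "norm ?z * norm ?z \<le> norm ?z * (c * norm w)" by (simp add: mult_ac)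
    then show ?thesis
      by (cases "?z = 0") (simp_all add: c_def)
  qed
  \<comment> \<open>Expanding the square shows that the maximiser is an eigenvector.\<close>
  have "(norm (?M *v u - c\<^sup>2 *\<^sub>R u))\<^sup>2 = (norm (?M *v u))\<^sup>2 - 2 * c\<^sup>2 * (u \<bullet> (?M *v u)) + (c\<^sup>2)\<^sup>2"
    using u unfolding power2_norm_eq_inner norm_eq_1
    by (simp add: inner_diff inner_commute power2_eq_square)
  also have "u \<bullet> (?M *v u) = c\<^sup>2"
    by (simp flip: matrix_vector_mul_assoc add: inner_conj_transpose c_def power2_norm_eq_inner)
  \<comment> \<open>As \<open>A *v u\<close> has norm \<open>c\<close>, the bound for the adjoint
    applies; the expansion is then at most c^4 - 2 c^4 + c^4 = 0.\<close>
  also have "(norm (?M *v u))\<^sup>2 \<le> (c\<^sup>2)\<^sup>2"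
  proof (rule power_mono)
    show "norm (?M *v u) \<le> c\<^sup>2"
      using adj[of "A *v u"] by (simp add: matrix_vector_mul_assoc c_def power2_eq_square)
  qed simp
  finally have "(norm (?M *v u - c\<^sup>2 *\<^sub>R u))\<^sup>2 \<le> 0" by (simp add: power2_eq_square)
  then have "?M *v u = complex_of_real (c\<^sup>2) *s u"
    by (simp add: vec_eq_iff scaleR_conv_of_real[where 'a=complex])
  moreover have "u \<noteq> 0" using u by auto
  ultimately have "complex_of_real (c\<^sup>2) \<in> eigenvalues ?M"
    by (auto simp: eigenvalues_def)
  then have "cmod (complex_of_real (c\<^sup>2)) \<le> spectral_radius ?M"
    unfolding spectral_radius_def
    by (intro Max_ge finite_imageI finite_eigenvalues_conj_transpose_mult imageI)
  then have "c \<le> spectral_norm A"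
    unfolding spectral_norm_def by (intro real_le_rsqrt) (simp add: norm_power)
  then show ?thesis
    using c[of v] by (meson mult_right_mono norm_ge_zero order_trans)
qed

text \<open>A point of the segment other than \<open>z\<close> lies strictly between
  \<open>z\<close> and one endpoint, and in a convex set the open segment from an interior point to
  a point of the closure is interior.\<close>

lemma convex_open_segment_subset_interior:
  fixes S :: "'a::euclidean_space set"
  assumes "convex S" "x \<in> S" "y \<in> S" "z \<in> interior S" "z \<in> open_segment x y"
  shows "open_segment x y \<subseteq> interior S"
proof
  fix w assume w: "w \<in> open_segment x y"
  have "w = z \<or> w \<in> open_segment z x \<or> w \<in> open_segment z y"
    using w assms(5) Un_closed_segment[of z x y]
    by (auto simp: open_segment_def closed_segment_commute)
  then show "w \<in> interior S"
    using in_interior_closure_convex_segment[OF assms(1,4)] assms closure_subset by blast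
qed

text \<open>The last hypothesis rules out segments inside the boundary of \<open>D\<close>, where no
  assumption ties \<open>DF\<close> to \<open>F\<close>.\<close>

theorem lemma6:
  fixes F :: "complex ^ 'n ^ 'm \<Rightarrow> complex ^ 'q ^ 'p"
    and DF :: "complex ^ 'n ^ 'm \<Rightarrow> complex ^ ('n \<times> 'm) ^ ('q \<times> 'p)"
    and D :: "(complex ^ 'n ^ 'm) set"
    and X Y :: "complex ^ 'n ^ 'm"
  assumes "convex D"
    and "continuous_on D F"
    and "\<And>Z. Z \<in> interior D \<Longrightarrow> has_jacobian F Z (DF Z)"
    and "X \<in> D" and "Y \<in> D"
    and "X \<noteq> Y \<Longrightarrow> \<exists>s\<in>{0<..<1::real}. s *\<^sub>R Y + (1 - s) *\<^sub>R X \<in> interior D"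
  shows "\<exists>t\<in>{0<..<1::real}.
      frobenius_norm (F Y - F X)
        \<le> norm (DF (t *\<^sub>R Y + (1 - t) *\<^sub>R X) *v vec_cols (Y - X)) \<and>
      norm (DF (t *\<^sub>R Y + (1 - t) *\<^sub>R X) *v vec_cols (Y - X))
        \<le> spectral_norm (DF (t *\<^sub>R Y + (1 - t) *\<^sub>R X)) * frobenius_norm (Y - X)"
proof -
  define \<gamma> where "\<gamma> t = t *\<^sub>R Y + (1 - t) *\<^sub>R X" for t :: real
  interpret V: linear "vec_cols :: complex ^ 'q ^ 'p \<Rightarrow> _" by (rule linear_vec_cols)
  have "\<exists>t\<in>{0<..<1}. norm (vec_cols (F Y) - vec_cols (F X)) \<le> norm (DF (\<gamma> t) *v vec_cols (Y - X))"
  proof (cases "X = Y")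
    case True
    \<comment> \<open>The left side is zero, so any point of the interval serves.\<close>
    then show ?thesis by (intro bexI[of _ "1/2"]) auto
  next
    case False
    then obtain s where s: "0 < s" "s < 1" "\<gamma> s \<in> interior D"
      using assms(6) by (auto simp: \<gamma>_def)
    have seg: "\<gamma> t \<in> open_segment X Y" if "0 < t" "t < 1" for t
      using that False by (auto simp: in_segment \<gamma>_def add.commute)
    have int: "\<gamma> t \<in> interior D" if "0 < t" "t < 1" for t
      using convex_open_segment_subset_interior[OF assms(1,4,5) s(3)] seg s that by blast
    have D: "\<gamma> t \<in> D" if "0 \<le> t" "t \<le> 1" for t
      using convexD[OF assms(1) assms(5,4), of t "1 - t"] that by (simp add: \<gamma>_def)
    let ?h = "\<lambda>t. vec_cols (F (\<gamma> t))"
    \<comment> \<open>The derivative of \<open>?h\<close> is applied to the length of the interval,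
      hence the factor \<open>1 - 0\<close>.\<close>
    have "\<exists>t\<in>{0<..<1}. norm (?h 1 - ?h 0) \<le> norm (DF (\<gamma> t) *v vec_cols ((1 - 0) *\<^sub>R (Y - X)))"
    proof (rule mvt_general)
      \<comment> \<open>\<open>X\<close> and \<open>Y\<close> may be boundary points, so on the
        closed interval only continuity on \<open>D\<close> is used.\<close>
      have "continuous_on {0..1} (\<lambda>t. F (\<gamma> t))"
        by (rule continuous_on_compose2[OF assms(2)])
          (auto simp: D \<gamma>_def[abs_def] intro!: continuous_intros, auto simp flip: \<gamma>_def intro: D)
      then show "continuous_on {0..1} ?h"
        using linear_vec_cols linear_conv_bounded_linear bounded_linear.continuous_on by blast
    next
      fix t :: real assume t: "0 < t" "t < 1"
      have "(\<gamma> has_derivative (\<lambda>d. d *\<^sub>R (Y - X))) (at t)"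
        unfolding \<gamma>_def[abs_def] by (auto intro!: derivative_eq_intros simp: algebra_simps)
      moreover have "((\<lambda>Z. vec_cols (F Z)) has_derivative (\<lambda>dZ. DF (\<gamma> t) *v vec_cols dZ)) (at (\<gamma> t))"
        using assms(3)[OF int[OF t]] by (simp add: has_jacobian_def)
      ultimately show "(?h has_derivative (\<lambda>d. DF (\<gamma> t) *v vec_cols (d *\<^sub>R (Y - X)))) (at t)"
        by (rule has_derivative_compose)
    qed simp
    then show ?thesis by (simp add: \<gamma>_def)
  qed
  then show ?thesis
    unfolding frobenius_norm_eq_norm \<gamma>_def
    using norm_mult_vec_le_spectral_norm V.diff by metis
qed

end
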